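(* Let $n\ge 3$. Let $A=(1,a_2,a_3,\dots,a_n)\in X$ and $B=(b_1,1,b_3,\dots,b_n)\in X$. Then the geodesic distance between $A$ and $B$ is equal to the minimum of the following numbers. (a) The number \[\max\bigl\{2-a_2-b_1,\ |a_3-b_3|,\ \dots,\ |a_n-b_n|\bigr\}.\] (b) For every integer $m$ with $1\le m\le n-2$, every sequence $(p_1,\dots,p_m)$ of distinct elements of $\{3,4,\dots,n\}$, and every choice of signs $\varepsilon_1,\dots,\varepsilon_m\in\{1,-1\}$, the maximum of the following numbers: \[2-a_2+\varepsilon_m b_{p_m};\] \[2+\varepsilon_1 a_{p_1}-b_1;\] \[2+\varepsilon_{t+1}a_{p_{t+1}}+\varepsilon_t b_{p_t}\quad\text{for } 1\le t\le m-1;\] \[|a_s-b_s|\quad\text{for all } s\in\{3,\dots,n\}\setminus\{p_1,\dots,p_m\}.\]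
   Context: Let $X=\{x\in\mathbb{R}^n:\|x\|_\infty=1\}$ be the unit sphere of $\mathbb{R}^n$ with the sup norm $\|x\|_\infty=\max_i|x_i|$. The geodesic distance between $A,B\in X$ is the one induced by the sup norm: the shortest arc length (measured with $\|\cdot\|_\infty$) among all curves lying on $X$ that join $A$ and $B$. Convention: only paths whose nonvoid intersection with each $(n-1)$-dimensional face ($\{x\in X:x_i=1\}$ or $\{x\in X:x_i=-1\}$) is a line segment are considered, so every path from $A$ to $B$ is a finite sequence of line segments $AC_1,C_1C_2,\dots,C_rB$, where each $C_i$ lies in an $(n-2)$-dimensional face of $X$. *)

theory Defs
  imports "HOL-Analysis.Analysis"
begin

definition sup_sphere :: "(real ^ 'n) set" where
  "sup_sphere = {x. infnorm x = 1}"

definition facet :: "'n \<Rightarrow> real \<Rightarrow> (real ^ 'n) set" where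
  "facet k \<sigma> = {x \<in> sup_sphere. x $ k = \<sigma>}"

text \<open>Curves are parametrised over the unit interval, as in the library. The arc length is the
  supremum of the lengths of inscribed polygons, measured with the sup norm; it is
  infinite for non-rectifiable curves.\<close>

definition sup_arc_length :: "(real \<Rightarrow> real ^ 'n) \<Rightarrow> ereal" where
  "sup_arc_length g =
     (SUP ts \<in> {ts. sorted ts \<and> set ts \<subseteq> {0..1}}.
        ereal (\<Sum>k < length ts - 1. infnorm (g (ts ! (k + 1)) - g (ts ! k))))"

text \<open>A curve on the sphere may meet a facet in a single point (when it passes through the relative
  boundary of that facet), so a line segment is allowed to be degenerate here.\<close>

definition admissible_path :: "real ^ 'n \<Rightarrow> real ^ 'n \<Rightarrow> (real \<Rightarrow> real ^ 'n) \<Rightarrow> bool" where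
  "admissible_path A B g \<longleftrightarrow>
     path g \<and> pathstart g = A \<and> pathfinish g = B \<and> path_image g \<subseteq> sup_sphere \<and>
     (\<forall>k. \<forall>\<sigma> \<in> {1, -1}. path_image g \<inter> facet k \<sigma> \<noteq> {} \<longrightarrow>
        (\<exists>C D. path_image g \<inter> facet k \<sigma> = closed_segment C D))"

text \<open>The geodesic distance is a minimum: it is attained by some curve, and not merely approached.\<close>

definition is_geodesic_dist :: "real ^ 'n \<Rightarrow> real ^ 'n \<Rightarrow> real \<Rightarrow> bool" where
  "is_geodesic_dist A B d \<longleftrightarrow>
     (\<exists>g. admissible_path A B g \<and> sup_arc_length g = ereal d) \<and>
     (\<forall>g. admissible_path A B g \<longrightarrow> ereal d \<le> sup_arc_length g)"

text \<open>The coordinates \<open>i\<close> and \<open>j\<close> play the roles of the first and the second coordinate.\<close>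

definition direct_number :: "'n \<Rightarrow> 'n \<Rightarrow> real ^ 'n \<Rightarrow> real ^ 'n \<Rightarrow> real" where
  "direct_number i j A B =
     Max ({2 - A $ j - B $ i} \<union> {\<bar>A $ s - B $ s\<bar> |s. s \<notin> {i, j}})"

definition detour_number ::
    "'n \<Rightarrow> 'n \<Rightarrow> real ^ 'n \<Rightarrow> real ^ 'n \<Rightarrow> nat \<Rightarrow> (nat \<Rightarrow> 'n) \<Rightarrow> (nat \<Rightarrow> real) \<Rightarrow> real" where
  "detour_number i j A B m p \<epsilon> =
     Max ({2 - A $ j + \<epsilon> m * B $ p m, 2 + \<epsilon> 1 * A $ p 1 - B $ i} \<union>
          {2 + \<epsilon> (t + 1) * A $ p (t + 1) + \<epsilon> t * B $ p t |t. 1 \<le> t \<and> t < m} \<union>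
          {\<bar>A $ s - B $ s\<bar> |s. s \<notin> {i, j} \<and> s \<notin> p ` {1..m}})"

text \<open>Extensional functions on \<open>{1..m}\<close> represent the sequences of length \<open>m\<close>.\<close>

definition detour_numbers :: "'n \<Rightarrow> 'n \<Rightarrow> real ^ 'n \<Rightarrow> real ^ 'n \<Rightarrow> real set" where
  "detour_numbers i j A B =
     {detour_number i j A B m p \<epsilon> |m p \<epsilon>.
        1 \<le> m \<and> m \<le> CARD('n) - 2 \<and>
        p \<in> {1..m} \<rightarrow>\<^sub>E - {i, j} \<and> inj_on p {1..m} \<and>
        \<epsilon> \<in> {1..m} \<rightarrow>\<^sub>E {1, -1}}"

end

theory Submission imports Defs
begin

text \<open>
  Let \<open>\<alpha> F\<close> and \<open>\<beta> F\<close> be the sup distances of \<open>A\<close> and \<open>B\<close> to a signed facet \<open>F\<close>. A sequence of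
  signed facets from \<open>x $ i = 1\<close> to \<open>x $ j = 1\<close> with pairwise distinct coordinates is called a chain
  of bound \<open>L\<close> if \<open>\<beta> F + \<alpha> G \<le> L\<close> for consecutive facets \<open>F\<close>, \<open>G\<close>. These sums are exactly the terms
  \<open>2 + \<epsilon> (t + 1) * A $ p (t + 1) + \<epsilon> t * B $ p t\<close> and their analogues at both ends, so the minimum in
  the theorem is the least \<open>L\<close> that is at least the sup distance of \<open>A\<close> and \<open>B\<close> and is the bound of
  some chain (\<open>number_gives_chain\<close>, \<open>chain_gives_number\<close>).

  A curve of length \<open>L\<close> that meets \<open>F\<close> and \<open>G\<close> at the same time satisfies \<open>\<beta> F + \<alpha> G \<le> L\<close>. Since the
  interval is connected, the facets visited by the curve contain a sequence from the first to the
  last facet in which consecutive facets are met simultaneously. It can be arranged that no two of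
  them are opposite: a curve that passes between opposite facets travels a distance of at least \<open>2\<close>
  there, which leaves enough room for a direct link from the first facet to a facet visited earlier,
  or from a facet visited later to the last facet. This is the lower bound
  (\<open>curve_gives_chain\<close>), valid for all curves on the sphere.

  Conversely, on a chain of bound \<open>L\<close> with the fewest facets, \<open>\<alpha>\<close> is increasing and \<open>\<beta>\<close> is decreasing, so
  a piecewise linear curve of length at most \<open>L\<close> can visit its facets in this order
  (\<open>chain_gives_curve\<close>).
\<close>

section \<open>The sup norm and the sphere\<close>

lemma infnorm_cart_le_iff:
  fixes x :: "real ^ 'n"
  shows "infnorm x \<le> c \<longleftrightarrow> (\<forall>k. \<bar>x $ k\<bar> \<le> c)"
proof
  assume "infnorm x \<le> c"
  then show "\<forall>k. \<bar>x $ k\<bar> \<le> c"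
    using component_le_infnorm_cart order_trans by blast
next
  assume c: "\<forall>k. \<bar>x $ k\<bar> \<le> c"
  show "infnorm x \<le> c"
    unfolding infnorm_cart by (rule cSup_least) (use c in auto)
qed

lemma infnorm_cart_attained:
  fixes x :: "real ^ 'n"
  obtains k where "infnorm x = \<bar>x $ k\<bar>"
proof -
  have "finite (range (\<lambda>k. \<bar>x $ k\<bar>))" "range (\<lambda>k. \<bar>x $ k\<bar>) \<noteq> {}" by auto
  then have "Max (range (\<lambda>k. \<bar>x $ k\<bar>)) \<in> range (\<lambda>k. \<bar>x $ k\<bar>)"
    by (rule Max_in)
  moreover have "infnorm x = Max (range (\<lambda>k. \<bar>x $ k\<bar>))"
    unfolding infnorm_cart by (subst cSup_eq_Max[symmetric]) (auto intro: arg_cong[where f = Sup])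
  ultimately obtain k where "infnorm x = \<bar>x $ k\<bar>" by (metis imageE)
  then show ?thesis by (rule that)
qed

lemma sup_sphere_iff:
  "x \<in> sup_sphere \<longleftrightarrow> (\<forall>k. \<bar>x $ k\<bar> \<le> 1) \<and> (\<exists>k. \<bar>x $ k\<bar> = 1)"
proof
  assume "x \<in> sup_sphere"
  then have "infnorm x = 1" by (simp add: sup_sphere_def)
  then show "(\<forall>k. \<bar>x $ k\<bar> \<le> 1) \<and> (\<exists>k. \<bar>x $ k\<bar> = 1)"
    using infnorm_cart_le_iff[of x 1] infnorm_cart_attained[of x] by (metis order_refl)
next
  assume "(\<forall>k. \<bar>x $ k\<bar> \<le> 1) \<and> (\<exists>k. \<bar>x $ k\<bar> = 1)"
  then show "x \<in> sup_sphere"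
    using infnorm_cart_le_iff[of x 1] component_le_infnorm_cart[of x]
    by (metis (mono_tags, lifting) antisym mem_Collect_eq sup_sphere_def)
qed

section \<open>Walks\<close>

text \<open>A walk has \<open>m\<close> interior vertices, numbered from \<open>1\<close> to \<open>m\<close>; its endpoints are numbered
  \<open>0\<close> and \<open>m + 1\<close>.\<close>

definition walk :: "('a \<Rightarrow> 'a \<Rightarrow> bool) \<Rightarrow> 'a \<Rightarrow> 'a \<Rightarrow> nat \<Rightarrow> (nat \<Rightarrow> 'a) \<Rightarrow> bool" where
  "walk R a b m F \<longleftrightarrow> F 0 = a \<and> F (Suc m) = b \<and> (\<forall>t\<le>m. R (F t) (F (Suc t)))"

text \<open>The renumbering that results when all vertices strictly between \<open>s\<close> and \<open>t\<close> are left out.\<close>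

definition leap :: "nat \<Rightarrow> nat \<Rightarrow> nat \<Rightarrow> nat" where
  "leap s t u = (if u \<le> s then u else u + (t - Suc s))"

lemma inj_leap: "inj (leap s t)"
  by (auto simp: inj_on_def leap_def split: if_splits)

lemma leap_le:
  assumes "s < t" "t \<le> Suc m" "u \<le> Suc (m - (t - Suc s))"
  shows "leap s t u \<le> Suc m"
  using assms by (auto simp: leap_def)

lemma walk_leap:
  assumes w: "walk R a b m F" and st: "s < t" "t \<le> Suc m" and R: "R (F s) (F t)"
  shows "walk R a b (m - (t - Suc s)) (F \<circ> leap s t)"
proof -
  have "R ((F \<circ> leap s t) u) ((F \<circ> leap s t) (Suc u))" if "u \<le> m - (t - Suc s)" for u
  proof -
    consider "u < s" | "u = s" | "u > s" by linarith
    then show ?thesis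
    proof cases
      case 1
      then show ?thesis using w st by (auto simp: walk_def leap_def)
    next
      case 2
      then have "leap s t u = s" "leap s t (Suc u) = t" using st by (auto simp: leap_def)
      then show ?thesis using R by simp
    next
      case 3
      then show ?thesis using w st that by (auto simp: walk_def leap_def)
    qed
  qed
  then show ?thesis using w st by (auto simp: walk_def leap_def)
qed

lemma shortest_walk_no_shortcut:
  assumes w: "walk R a b m F" and min: "\<And>m' F'. m' < m \<Longrightarrow> \<not> walk R a b m' F'"
    and st: "s < t" "t \<le> Suc m" and R: "R (F s) (F t)"
  shows "t = Suc s"
proof (rule ccontr)
  assume "t \<noteq> Suc s"
  with st have "m - (t - Suc s) < m" by auto
  with min walk_leap[OF w st R] show False by blast
qed

lemma shortest_walk_inj:
  assumes w: "walk R a b m F" and min: "\<And>m' F'. m' < m \<Longrightarrow> \<not> walk R a b m' F'"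
    and "a \<noteq> b"
  shows "inj_on F {..Suc m}"
proof (rule linorder_inj_onI')
  fix s t assume s: "s \<in> {..Suc m}" "t \<in> {..Suc m}" "s < t"
  show "F s \<noteq> F t"
  proof
    assume eq: "F s = F t"
    show False
    proof (cases "t \<le> m")
      case True
      then have "R (F s) (F (Suc t))" using w eq by (auto simp: walk_def)
      then show False
        using shortest_walk_no_shortcut[OF w min, of s "Suc t"] s True by auto
    next
      case False
      then have t: "t = Suc m" using s by auto
      then obtain s' where s': "s = Suc s'" using eq \<open>a \<noteq> b\<close> w by (cases s) (auto simp: walk_def)
      then have "R (F s') (F t)" using w eq[symmetric] s t by (auto simp: walk_def)
      then show False
        using shortest_walk_no_shortcut[OF w min, of s' t] s s' by auto
    qed
  qed
qed

lemma rtranclp_imp_shortest_walk: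
  assumes "R\<^sup>*\<^sup>* a b" "a \<noteq> b"
  obtains m F where "walk R a b m F" "\<And>m' F'. m' < m \<Longrightarrow> \<not> walk R a b m' F'"
proof -
  obtain n where "(R ^^ n) a b" using rtranclp_imp_relpowp[OF assms(1)] by blast
  then obtain F where F: "F 0 = a" "F n = b" "\<forall>i<n. R (F i) (F (Suc i))"
    unfolding relpowp_fun_conv by blast
  then obtain m where "n = Suc m" using assms(2) by (cases n) auto
  with F have ex: "\<exists>m F. walk R a b m F" by (auto simp: walk_def less_Suc_eq_le)
  define m where "m = (LEAST m. \<exists>F. walk R a b m F)"
  have "\<exists>F. walk R a b m F" unfolding m_def by (rule LeastI_ex[OF ex])
  moreover have "\<not> walk R a b m' F'" if "m' < m" for m' F'
    using not_less_Least[of m' "\<lambda>m. \<exists>F. walk R a b m F"] that m_def by auto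
  ultimately show ?thesis using that by blast
qed

section \<open>Chains of signed facets\<close>

text \<open>A facet is represented by its coordinate together with the sign of that coordinate. For a point
  of the sphere, its sup distance to the facet is the following number.\<close>

definition gap :: "real ^ 'n \<Rightarrow> 'n \<times> real \<Rightarrow> real" where
  "gap x F = 1 - snd F * x $ fst F"

text \<open>A curve of length \<open>L\<close> from \<open>A\<close> to \<open>B\<close> that has a point on both \<open>F\<close> and \<open>G\<close> forces this
  inequality.\<close>

definition linked :: "real ^ 'n \<Rightarrow> real ^ 'n \<Rightarrow> real \<Rightarrow> 'n \<times> real \<Rightarrow> 'n \<times> real \<Rightarrow> bool" where
  "linked A B L F G \<longleftrightarrow> gap B F + gap A G \<le> L"

text \<open>A chain has \<open>m\<close> interior facets, and all its coordinates are distinct. The detour given by \<open>p\<close> and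
  \<open>\<epsilon>\<close> corresponds to the interior facets \<open>(p t, - \<epsilon> t)\<close>; note the change of sign.\<close>

definition facet_chain ::
    "'n \<Rightarrow> 'n \<Rightarrow> real ^ 'n \<Rightarrow> real ^ 'n \<Rightarrow> real \<Rightarrow> nat \<Rightarrow> (nat \<Rightarrow> 'n \<times> real) \<Rightarrow> bool" where
  "facet_chain i j A B L m F \<longleftrightarrow>
     walk (linked A B L) (i, 1) (j, 1) m F \<and>
     inj_on (fst \<circ> F) {..Suc m} \<and> (\<forall>t\<le>Suc m. snd (F t) \<in> {1, -1})"

lemma facet_chain_leap:
  assumes c: "facet_chain i j A B L m F" and st: "s < t" "t \<le> Suc m"
    and R: "linked A B L (F s) (F t)"
  shows "facet_chain i j A B L (m - (t - Suc s)) (F \<circ> leap s t)"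
proof -
  have *: "leap s t u \<le> Suc m" if "u \<le> Suc (m - (t - Suc s))" for u
    using leap_le[OF st that] .
  have "inj_on ((fst \<circ> F) \<circ> leap s t) {..Suc (m - (t - Suc s))}"
    by (rule comp_inj_on)
       (use c * inj_leap in \<open>auto simp: facet_chain_def intro: inj_on_subset\<close>)
  with c * walk_leap[of "linked A B L", OF _ st R] show ?thesis
    by (auto simp: facet_chain_def comp_assoc)
qed

section \<open>Curves force chains\<close>

text \<open>The times spent on the individual facets are closed sets that cover the unit interval, and the
  interval is connected.\<close>

lemma facets_connected_along_path:
  fixes g :: "real \<Rightarrow> real ^ 'n"
  assumes "path g" and sph: "path_image g \<subseteq> sup_sphere" and i: "g 0 $ i = 1" and j: "g 1 $ j = 1"
  defines "V \<equiv> \<lambda>t (F :: 'n \<times> real). snd F \<in> {1, -1} \<and> g t $ fst F = snd F"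
  shows "(\<lambda>F G. \<exists>t\<in>{0..1}. V t F \<and> V t G)\<^sup>*\<^sup>* (i, 1) (j, 1)"
proof -
  let ?C = "\<lambda>F G. \<exists>t\<in>{0..1}. V t F \<and> V t G"
  define D where "D = (UNIV :: 'n set) \<times> {1, -1 :: real}"
  define S where "S = {F \<in> D. ?C\<^sup>*\<^sup>* (i, 1) F}"
  have fin: "finite D" unfolding D_def by simp
  have VD: "V t F \<Longrightarrow> F \<in> D" for t F unfolding V_def D_def by (cases F) auto
  have cont: "continuous_on {0..1} g" using \<open>path g\<close> by (simp add: path_def)
  have closed_V: "closed {t \<in> {0..1}. V t F}" for F
  proof (cases "snd F \<in> {1, -1}")
    case True
    have "closed ({0..1} \<inter> (\<lambda>t. g t $ fst F) -` {snd F})"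
      by (intro continuous_closed_preimage continuous_intros cont)
    then show ?thesis using True by (simp add: V_def vimage_def Int_def)
  next
    case False
    then show ?thesis by (simp add: V_def)
  qed
  define P where "P = (\<Union>F\<in>S. {t \<in> {0..1}. V t F})"
  define Q where "Q = (\<Union>F\<in>D - S. {t \<in> {0..1}. V t F})"
  have PQ: "closed P" "closed Q"
    unfolding P_def Q_def using fin closed_V by (auto simp: S_def intro!: closed_UN)
  have cover: "{0..1} \<subseteq> P \<union> Q"
  proof
    fix t :: real assume t: "t \<in> {0..1}"
    then have "g t \<in> sup_sphere" using sph by (auto simp: path_image_def)
    then obtain k where "\<bar>g t $ k\<bar> = 1" unfolding sup_sphere_iff by blast
    then have "V t (k, g t $ k)" by (auto simp: V_def)
    then show "t \<in> P \<union> Q" using VD[of t "(k, g t $ k)"] t unfolding P_def Q_def by blast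
  qed
  have disj: "P \<inter> Q = {}"
  proof (rule ccontr)
    assume "P \<inter> Q \<noteq> {}"
    then obtain t F G where t: "t \<in> {0..1}" "V t F" "V t G" "F \<in> S" "G \<in> D - S"
      unfolding P_def Q_def by blast
    then have "?C F G" by blast
    with t have "G \<in> S" unfolding S_def by (auto intro: rtranclp.rtrancl_into_rtrancl)
    with t show False by blast
  qed
  have "V 0 (i, 1)" using i by (simp add: V_def)
  then have 0: "0 \<in> P" unfolding P_def S_def using VD by force
  have V1: "V 1 (j, 1)" using j by (simp add: V_def)
  have "{0..1} \<inter> Q = {}"
    using connected_Icc[of 0 "1::real"] PQ cover disj 0
    unfolding connected_closed by (metis Int_iff atLeastAtMost_iff disjoint_iff order_refl zero_le_one)
  then have "1 \<notin> Q" by (metis atLeastAtMost_iff disjoint_iff order_refl zero_le_one)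
  then have "(j, 1) \<notin> D - S" unfolding Q_def using V1 by force
  then have "(j, 1) \<in> S" using VD[OF V1] by blast
  then show ?thesis unfolding S_def by blast
qed

text \<open>The hypothesis on \<open>L\<close> says that inscribed polygons with at most two edges have length
  at most \<open>L\<close>; nothing more about the length of the curve is needed.

  If \<open>L < 4\<close>, consider facets as adjacent when the curve has a point on both, and moreover allow a
  direct step from the first facet to any facet visited before a point at sup distance at least \<open>2\<close>, and a
  direct step to the last facet from any facet visited after such a point. All these steps link
  facets in the sense above. On a shortest walk, two opposite facets cannot both occur: whichever is
  visited first allows a shortcut.\<close>

lemma curve_gives_chain:
  fixes g :: "real \<Rightarrow> real ^ 'n"
  assumes "path g" and sph: "path_image g \<subseteq> sup_sphere"
    and g0: "g 0 = A" and g1: "g 1 = B" and Ai: "A $ i = 1" and Bj: "B $ j = 1" and "i \<noteq> j"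
    and L: "\<And>x y z. 0 \<le> x \<Longrightarrow> x \<le> y \<Longrightarrow> y \<le> z \<Longrightarrow> z \<le> 1 \<Longrightarrow>
              infnorm (g y - g x) + infnorm (g z - g y) \<le> L"
  obtains m F where "facet_chain i j A B L m F"
proof (cases "L < 4")
  case False
  have "g 0 \<in> sup_sphere" "g 1 \<in> sup_sphere" using sph by (auto simp: path_image_def)
  then have "\<bar>A $ j\<bar> \<le> 1" "\<bar>B $ i\<bar> \<le> 1" using g0 g1 by (auto simp: sup_sphere_iff)
  then have "facet_chain i j A B L 0 (\<lambda>t. if t = 0 then (i, 1) else (j, 1))"
    using False \<open>i \<noteq> j\<close>
    by (auto simp: facet_chain_def walk_def linked_def gap_def inj_on_def le_Suc_eq)
  then show ?thesis using that by blast
next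
  case True
  define V where "V = (\<lambda>t (F :: 'n \<times> real). snd F \<in> {1, -1} \<and> g t $ fst F = snd F)"
  define early where "early = (\<lambda>t. \<exists>y\<in>{t..1}. infnorm (g y - g t) \<ge> 2)"
  define late where "late = (\<lambda>t. \<exists>x\<in>{0..t}. infnorm (g t - g x) \<ge> 2)"
  define R where "R = (\<lambda>F G. (\<exists>t\<in>{0..1}. V t F \<and> V t G)
      \<or> (F = (i, 1) \<and> (\<exists>t\<in>{0..1}. V t G \<and> early t))
      \<or> (G = (j, 1) \<and> (\<exists>t\<in>{0..1}. V t F \<and> late t)))"
  have sphere: "\<bar>g t $ k\<bar> \<le> 1" if "t \<in> {0..1}" for t k
    using sph that unfolding path_image_def sup_sphere_iff by (meson image_subset_iff sup_sphere_iff)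
  have V_i: "V 0 (i, 1)" and V_j: "V 1 (j, 1)" using g0 g1 Ai Bj by (auto simp: V_def)
  have gapA: "gap A F \<le> infnorm (g t - A)" if "V t F" for t F
    using that component_le_infnorm_cart[of "g t - A" "fst F"] by (auto simp: V_def gap_def)
  have gapB: "gap B F \<le> infnorm (B - g t)" if "V t F" for t F
    using that component_le_infnorm_cart[of "B - g t" "fst F"] by (auto simp: V_def gap_def)
  have far: "infnorm (g y - g x) \<ge> 2" if "V x (k, \<sigma>)" "V y (k, - \<sigma>)" for x y k \<sigma>
    using that component_le_infnorm_cart[of "g y - g x" k] by (auto simp: V_def)
  have not_both: False if el: "early t" "late t" "t \<in> {0..1}" for t
  proof -
    obtain x y where "x \<in> {0..t}" "y \<in> {t..1}" "infnorm (g t - g x) \<ge> 2" "infnorm (g y - g t) \<ge> 2"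
      using el unfolding early_def late_def by blast
    then show False using L[of x t y] True by auto
  qed
  have gap2: "gap B (i, 1) \<le> 2" "gap A (j, 1) \<le> 2"
    using sphere[of 0 j] sphere[of 1 i] g0 g1 by (auto simp: gap_def)
  have R_linked: "linked A B L F G" if FG: "R F G" for F G
    using FG unfolding R_def
  proof (elim disjE conjE bexE)
    fix t assume "t \<in> {0..1}" "V t F" "V t G"
    then show ?thesis using gapB[of t F] gapA[of t G] L[of 0 t 1] g0 g1 by (auto simp: linked_def)
  next
    fix t assume t: "F = (i, 1)" "t \<in> {0..1}" "V t G" "early t"
    then obtain y where "y \<in> {t..1}" "infnorm (g y - g t) \<ge> 2" unfolding early_def by blast
    then show ?thesis using t gapA[of t G] L[of 0 t y] g0 gap2 by (auto simp: linked_def)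
  next
    fix t assume t: "G = (j, 1)" "t \<in> {0..1}" "V t F" "late t"
    then obtain x where "x \<in> {0..t}" "infnorm (g t - g x) \<ge> 2" unfolding late_def by blast
    then show ?thesis using t gapB[of t F] L[of x t 1] g1 gap2 by (auto simp: linked_def)
  qed
  have "(\<lambda>F G. \<exists>t\<in>{0..1}. V t F \<and> V t G)\<^sup>*\<^sup>* (i, 1) (j, 1)"
    using facets_connected_along_path[OF \<open>path g\<close> sph, of i j] g0 g1 Ai Bj unfolding V_def by auto
  then have "R\<^sup>*\<^sup>* (i, 1) (j, 1)"
    by (rule rtranclp_mono[THEN predicate2D, rotated]) (auto simp: R_def)
  then obtain m F where w: "walk R (i, 1) (j, 1) m F"
    and min: "\<And>m' F'. m' < m \<Longrightarrow> \<not> walk R (i, 1) (j, 1) m' F'"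
    by (rule rtranclp_imp_shortest_walk) (use \<open>i \<noteq> j\<close> in auto)
  have no_shortcut: "t = Suc s" if "R (F s) (F t)" "s < t" "t \<le> Suc m" for s t
    using shortest_walk_no_shortcut[OF w min that(2,3,1)] .
  have inj: "inj_on F {..Suc m}"
    by (rule shortest_walk_inj[OF w min]) (use \<open>i \<noteq> j\<close> in auto)
  have F0: "F 0 = (i, 1)" and Fm: "F (Suc m) = (j, 1)"
    and step: "t \<le> m \<Longrightarrow> R (F t) (F (Suc t))" for t
    using w by (auto simp: walk_def)
  have F_eq: "F s = F t \<longleftrightarrow> s = t" if "s \<le> Suc m" "t \<le> Suc m" for s t
    using inj that by (auto dest: inj_onD)
  have F_i: "F t = (i, 1) \<longleftrightarrow> t = 0" if "t \<le> Suc m" for t using F_eq[of t 0] F0 that by auto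
  have F_j: "F t = (j, 1) \<longleftrightarrow> t = Suc m" if "t \<le> Suc m" for t using F_eq[of t "Suc m"] Fm that by auto
  have common: "\<exists>t\<in>{0..1}. V t (F s) \<and> V t (F (Suc s))" if "1 \<le> s" "s < m" for s
    using step[of s] that F_i[of s] F_j[of "Suc s"] unfolding R_def by auto
  have signs: "snd (F t) \<in> {1, -1}" if "t \<le> Suc m" for t
  proof (cases t)
    case 0
    then show ?thesis using F0 by simp
  next
    case (Suc s)
    then show ?thesis using step[of s] Fm that unfolding R_def V_def by auto
  qed
  have early_first: "R (F 0) G" if "V t G" "early t" "t \<in> {0..1}" for t G
    using that F0 unfolding R_def by blast
  have late_last: "R G (F (Suc m))" if "V t G" "late t" "t \<in> {0..1}" for t G
    using that Fm unfolding R_def by blast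
  have no_minus_i: "F s \<noteq> (i, -1)" if s: "s \<le> Suc m" for s
  proof
    assume Fs: "F s = (i, -1)"
    have "s \<noteq> 0" "s \<noteq> Suc m" using Fs F0 Fm \<open>i \<noteq> j\<close> by (metis Pair_inject one_neq_neg_one, metis Pair_inject)
    then obtain r where r: "s = Suc r" "r < m" using s by (cases s) auto
    have late: "late t" if "V t (F s)" "t \<in> {0..1}" for t
      unfolding late_def using far[OF V_i, of t] that Fs by (intro bexI[of _ 0]) auto
    consider (meet) t where "t \<in> {0..1}" "V t (F r)" "V t (F s)"
      | (jump) t where "t \<in> {0..1}" "V t (F s)" "early t"
      using step[of r] r F_j[of s] \<open>s \<noteq> Suc m\<close> s unfolding R_def by auto
    then show False
    proof cases
      case meet
      then have "R (F r) (F (Suc m))" using late_last late by blast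
      then show False using no_shortcut[of r "Suc m"] r by auto
    next
      case jump
      then show False using not_both late by blast
    qed
  qed
  have no_minus_j: "F s \<noteq> (j, -1)" if s: "s \<le> Suc m" for s
  proof
    assume Fs: "F s = (j, -1)"
    have s: "1 \<le> s" "s \<le> m" using Fs F0 Fm \<open>i \<noteq> j\<close> s
      by (metis One_nat_def Pair_inject Suc_leI gr0I, metis Pair_inject le_SucE one_neq_neg_one)
    have early: "early t" if "V t (F s)" "t \<in> {0..1}" for t
    proof -
      have "infnorm (g 1 - g t) \<ge> 2" using far[of t j "-1" 1] V_j that Fs by auto
      then show ?thesis unfolding early_def using that by (intro bexI[of _ 1]) auto
    qed
    consider (meet) t where "t \<in> {0..1}" "V t (F s)" "V t (F (Suc s))"
      | (jump) t where "t \<in> {0..1}" "V t (F s)" "late t"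
      using step[of s] s F_i[of s] unfolding R_def by auto
    then show False
    proof cases
      case meet
      then have "R (F 0) (F (Suc s))" using early_first early by blast
      then show False using no_shortcut[of 0 "Suc s"] s by auto
    next
      case jump
      then show False using not_both early by blast
    qed
  qed
  have no_opposite: "F t \<noteq> (fst (F s), - snd (F s))" if st: "1 \<le> s" "s < t" "t \<le> m" for s t
  proof
    assume opp: "F t = (fst (F s), - snd (F s))"
    obtain p where p: "p \<in> {0..1}" "V p (F s)" "V p (F (Suc s))" using common[of s] st by auto
    obtain r where r: "t = Suc r" "1 \<le> r" using st by (cases t) auto
    obtain q where q: "q \<in> {0..1}" "V q (F r)" "V q (F t)" using common[of r] st r by auto
    have far1: "infnorm (g q - g p) \<ge> 2" using far[of p "fst (F s)" "snd (F s)" q] p q opp by simp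
    show False
    proof (cases "p \<le> q")
      case True
      then have "early p" unfolding early_def using far1 q by (intro bexI[of _ q]) auto
      then have "R (F 0) (F (Suc s))" using early_first p by blast
      then show False using no_shortcut[of 0 "Suc s"] st by auto
    next
      case False
      then have "early q" unfolding early_def using far1 p infnorm_sub[of "g p" "g q"]
        by (intro bexI[of _ p]) auto
      then have "R (F 0) (F t)" using early_first q by blast
      then show False using no_shortcut[of 0 t] st by auto
    qed
  qed
  have "inj_on (fst \<circ> F) {..Suc m}"
  proof (rule linorder_inj_onI')
    fix s t assume st: "s \<in> {..Suc m}" "t \<in> {..Suc m}" "s < t"
    show "(fst \<circ> F) s \<noteq> (fst \<circ> F) t"
    proof
      assume eq: "(fst \<circ> F) s = (fst \<circ> F) t"
      have "F s \<noteq> F t" using F_eq st by auto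
      then have opp: "F t = (fst (F s), - snd (F s))"
        using eq signs[of s] signs[of t] st by (cases "F s"; cases "F t") auto
      show False
      proof (cases "s = 0 \<or> t = Suc m")
        case True
        then show False using opp F0 Fm no_minus_i[of t] no_minus_j[of s] eq signs[of s] st
          by (cases "F s") auto
      next
        case False
        then show False using no_opposite[of s t] opp st by auto
      qed
    qed
  qed
  then have "facet_chain i j A B L m F"
    using w R_linked signs unfolding facet_chain_def walk_def by blast
  then show ?thesis using that by blast
qed

lemma sup_arc_length_ge_two_edges:
  assumes "0 \<le> x" "x \<le> y" "y \<le> z" "z \<le> 1"
  shows "ereal (infnorm (g y - g x) + infnorm (g z - g y)) \<le> sup_arc_length g"
proof -
  have "[x, y, z] \<in> {ts. sorted ts \<and> set ts \<subseteq> {0..1}}" using assms by auto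
  then have "ereal (\<Sum>k<length [x, y, z] - 1. infnorm (g ([x, y, z] ! (k + 1)) - g ([x, y, z] ! k)))
      \<le> sup_arc_length g"
    unfolding sup_arc_length_def by (rule SUP_upper)
  then show ?thesis by (simp add: numeral_2_eq_2)
qed

section \<open>Chains give curves\<close>

text \<open>The curve \<open>g\<close> runs affinely from \<open>g p\<close> to \<open>g q\<close> during \<open>{p..q}\<close>.\<close>

definition affine_between :: "(real \<Rightarrow> 'a :: real_vector) \<Rightarrow> real \<Rightarrow> real \<Rightarrow> bool" where
  "affine_between g p q \<longleftrightarrow>
     (\<forall>l\<in>{0..1}. g ((1 - l) * p + l * q) = (1 - l) *\<^sub>R g p + l *\<^sub>R g q)"

lemma image_affine_between:
  assumes "affine_between g p q" "p \<le> q"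
  shows "g ` {p..q} = closed_segment (g p) (g q)"
proof -
  have "g ` {p..q} = g ` ((\<lambda>l. (1 - l) * p + l * q) ` {0..1})"
    using closed_segment_eq_real_ivl1[OF \<open>p \<le> q\<close>] by (simp add: closed_segment_image_interval)
  also have "\<dots> = (\<lambda>l. (1 - l) *\<^sub>R g p + l *\<^sub>R g q) ` {0..1}"
    using assms(1) by (auto simp: affine_between_def image_image)
  finally show ?thesis by (simp add: closed_segment_image_interval)
qed

lemma sup_arc_length_le:
  fixes g :: "real \<Rightarrow> real ^ 'n"
  assumes lip: "\<And>x y. 0 \<le> x \<Longrightarrow> x \<le> y \<Longrightarrow> y \<le> 1 \<Longrightarrow> infnorm (g y - g x) \<le> L * (y - x)"
    and "0 \<le> L"
  shows "sup_arc_length g \<le> ereal L"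
  unfolding sup_arc_length_def
proof (rule SUP_least)
  fix ts :: "real list"
  assume "ts \<in> {ts. sorted ts \<and> set ts \<subseteq> {0..1}}"
  then have s: "sorted ts" and sub: "set ts \<subseteq> {0..1}" by auto
  have "(\<Sum>k<length ts - 1. infnorm (g (ts ! (k + 1)) - g (ts ! k)))
      \<le> (\<Sum>k<length ts - 1. L * (ts ! Suc k - ts ! k))"
  proof (rule sum_mono)
    fix k assume "k \<in> {..<length ts - 1}"
    then have k: "Suc k < length ts" by auto
    then have "ts ! k \<in> {0..1}" "ts ! Suc k \<in> {0..1}" using sub nth_mem by (meson Suc_lessD subsetD)+
    then show "infnorm (g (ts ! (k + 1)) - g (ts ! k)) \<le> L * (ts ! Suc k - ts ! k)"
      using lip sorted_nth_mono[OF s, of k "Suc k"] k by auto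
  qed
  also have "\<dots> = L * (ts ! (length ts - 1) - ts ! 0)"
    by (simp add: sum_distrib_left[symmetric] sum_lessThan_telescope)
  also have "\<dots> \<le> L"
  proof (cases "ts = []")
    case False
    then have "ts ! (length ts - 1) \<in> {0..1}" "ts ! 0 \<in> {0..1}"
      using sub nth_mem by (metis diff_less length_greater_0_conv subsetD zero_less_one)+
    then show ?thesis using \<open>0 \<le> L\<close> by (intro mult_left_le) auto
  qed (use \<open>0 \<le> L\<close> in simp)
  finally show "ereal (\<Sum>k<length ts - 1. infnorm (g (ts ! (k + 1)) - g (ts ! k))) \<le> ereal L"
    by simp
qed

text \<open>A Lipschitz curve is admissible if it occupies each facet during a possibly degenerate time
  interval on which it is affine.\<close>

lemma admissible_pathI:
  fixes g :: "real \<Rightarrow> real ^ 'n"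
  assumes lip: "\<And>x y. 0 \<le> x \<Longrightarrow> x \<le> y \<Longrightarrow> y \<le> 1 \<Longrightarrow> infnorm (g y - g x) \<le> L * (y - x)"
    and "g 0 = A" "g 1 = B" and sph: "\<And>t. 0 \<le> t \<Longrightarrow> t \<le> 1 \<Longrightarrow> g t \<in> sup_sphere"
    and times: "\<And>k \<sigma>. \<sigma> \<in> {1, -1} \<Longrightarrow> {t\<in>{0..1}. g t $ k = \<sigma>} = {} \<or>
      (\<exists>p q. p \<le> q \<and> {t\<in>{0..1}. g t $ k = \<sigma>} = {p..q} \<and> affine_between g p q)"
  shows "admissible_path A B g"
proof -
  have lip2: "\<bar>g y $ k - g x $ k\<bar> \<le> L * \<bar>y - x\<bar>" if "x \<in> {0..1}" "y \<in> {0..1}" for x y k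
  proof (cases "x \<le> y")
    case True
    then show ?thesis using lip[of x y] that component_le_infnorm_cart[of "g y - g x" k] by auto
  next
    case False
    then show ?thesis using lip[of y x] that component_le_infnorm_cart[of "g x - g y" k] by auto
  qed
  have "continuous_on {0..1} (\<lambda>t. g t $ k)" for k
  proof (rule lipschitz_on_continuous_on)
    have "0 \<le> L" using lip2[of 0 1 k] by auto
    then show "L-lipschitz_on {0..1} (\<lambda>t. g t $ k)"
      by (rule lipschitz_onI[rotated]) (use lip2 in \<open>auto simp: dist_real_def\<close>)
  qed
  then have "continuous_on {0..1} (\<lambda>t. \<chi> k. g t $ k)" by (rule continuous_on_vec_lambda)
  then have "path g" by (simp add: path_def)
  moreover have "path_image g \<subseteq> sup_sphere" using sph by (auto simp: path_image_def)
  moreover have "\<exists>C D. path_image g \<inter> facet k \<sigma> = closed_segment C D"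
    if \<sigma>: "\<sigma> \<in> {1, -1}" and ne: "path_image g \<inter> facet k \<sigma> \<noteq> {}" for k \<sigma>
  proof -
    have eq: "path_image g \<inter> facet k \<sigma> = g ` {t\<in>{0..1}. g t $ k = \<sigma>}"
      using sph by (auto simp: path_image_def facet_def)
    have "{t\<in>{0..1}. g t $ k = \<sigma>} \<noteq> {}" using ne unfolding eq by blast
    then obtain p q where pq: "p \<le> q" "{t\<in>{0..1}. g t $ k = \<sigma>} = {p..q}" "affine_between g p q"
      using times[OF \<sigma>, of k] by blast
    show ?thesis unfolding eq pq(2) image_affine_between[OF pq(3,1)] by blast
  qed
  ultimately show ?thesis
    using assms(2,3) by (auto simp: admissible_path_def pathstart_def pathfinish_def)
qed

lemma affine_between_refl: "affine_between g p p"
  by (simp add: affine_between_def algebra_simps flip: scaleR_add_left)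

lemma abs_convex_combination_le:
  fixes a b c :: real
  assumes "\<bar>a\<bar> \<le> c" "\<bar>b\<bar> \<le> c" "0 \<le> t" "t \<le> 1"
  shows "\<bar>(1 - t) * a + t * b\<bar> \<le> c"
proof -
  have "\<bar>(1 - t) * a + t * b\<bar> \<le> (1 - t) * \<bar>a\<bar> + t * \<bar>b\<bar>"
    using assms abs_triangle_ineq[of "(1 - t) * a" "t * b"] by (simp add: abs_mult)
  also have "\<dots> \<le> (1 - t) * c + t * c"
    using assms by (intro add_mono mult_left_mono) auto
  finally show ?thesis by (simp add: algebra_simps)
qed

lemma straight_coordinate_eq_sign:
  fixes a b :: real
  assumes "\<sigma> \<in> {1, -1}" "\<bar>a\<bar> \<le> 1" "\<bar>b\<bar> \<le> 1" "0 \<le> t" "t \<le> 1"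
  shows "(1 - t) * a + t * b = \<sigma> \<longleftrightarrow> (t = 0 \<or> b = \<sigma>) \<and> (t = 1 \<or> a = \<sigma>)"
proof -
  have "0 \<le> 1 - \<sigma> * a" "0 \<le> 1 - \<sigma> * b" using assms by auto
  then have nonneg: "0 \<le> (1 - t) * (1 - \<sigma> * a)" "0 \<le> t * (1 - \<sigma> * b)"
    using assms(4,5) by (auto intro!: mult_nonneg_nonneg)
  have "(1 - t) * a + t * b = \<sigma> \<longleftrightarrow> (1 - t) * (1 - \<sigma> * a) + t * (1 - \<sigma> * b) = 0"
    using assms(1) by (auto simp: algebra_simps)
  also have "\<dots> \<longleftrightarrow> (1 - t) * (1 - \<sigma> * a) = 0 \<and> t * (1 - \<sigma> * b) = 0"
    using nonneg by (rule add_nonneg_eq_0_iff)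
  also have "\<dots> \<longleftrightarrow> (t = 0 \<or> b = \<sigma>) \<and> (t = 1 \<or> a = \<sigma>)"
    using assms(1) by auto
  finally show ?thesis .
qed

lemma straight_coordinate_times:
  fixes a b :: real
  assumes "\<sigma> \<in> {1, -1}" "\<bar>a\<bar> \<le> 1" "\<bar>b\<bar> \<le> 1"
  shows "{t\<in>{0..1}. (1 - t) * a + t * b = \<sigma>} =
    (if a = \<sigma> then if b = \<sigma> then {0..1} else {0..0} else if b = \<sigma> then {1..1} else {})"
proof -
  have "{t\<in>{0..1}. (1 - t) * a + t * b = \<sigma>} =
    {t\<in>{0..1}. (t = 0 \<or> b = \<sigma>) \<and> (t = 1 \<or> a = \<sigma>)}"
    using straight_coordinate_eq_sign[OF assms] by (intro Collect_cong conj_cong refl) simp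
  also have "\<dots> = (if a = \<sigma> then if b = \<sigma> then {0..1} else {0..0}
    else if b = \<sigma> then {1..1} else {})"
    by (auto simp del: atLeastAtMost_singleton)
  finally show ?thesis .
qed

lemma admissible_path_straight:
  fixes A B :: "real ^ 'n"
  assumes A: "A \<in> sup_sphere" and B: "B \<in> sup_sphere"
    and common: "\<bar>\<sigma>\<bar> = 1" "A $ k = \<sigma>" "B $ k = \<sigma>" and L: "infnorm (B - A) \<le> L"
  obtains g where "admissible_path A B g" "sup_arc_length g \<le> ereal L"
proof -
  define g where "g = (\<lambda>t :: real. (1 - t) *\<^sub>R A + t *\<^sub>R B)"
  have lip: "infnorm (g y - g x) \<le> L * (y - x)" if "x \<le> y" for x y
  proof -
    have "g y - g x = (y - x) *\<^sub>R (B - A)" by (simp add: g_def algebra_simps)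
    then have "infnorm (g y - g x) = (y - x) * infnorm (B - A)" using that by (simp add: infnorm_mul)
    then show ?thesis using mult_left_mono[OF L, of "y - x"] that by (simp add: mult.commute)
  qed
  have bound: "\<bar>A $ l\<bar> \<le> 1" "\<bar>B $ l\<bar> \<le> 1" for l using A B by (auto simp: sup_sphere_iff)
  have aff: "affine_between g 0 1" by (simp add: affine_between_def g_def)
  have "0 \<le> L" using L infnorm_pos_le[of "B - A"] by linarith
  have "admissible_path A B g"
  proof (rule admissible_pathI)
    show "g t \<in> sup_sphere" if "0 \<le> t" "t \<le> 1" for t
    proof -
      have "\<bar>g t $ l\<bar> \<le> 1" for l
        using abs_convex_combination_le[OF bound[of l] that] by (simp add: g_def)
      moreover have "g t $ k = \<sigma>" using common by (simp add: g_def algebra_simps)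
      ultimately show ?thesis using common sup_sphere_iff by metis
    qed
    fix l and \<tau> :: real assume "\<tau> \<in> {1, -1}"
    from straight_coordinate_times[OF this bound[of l]]
    have *: "{t\<in>{0..1}. g t $ l = \<tau>} = (if A $ l = \<tau> then if B $ l = \<tau> then {0..1} else {0..0}
       else if B $ l = \<tau> then {1..1} else {})"
      by (simp add: g_def)
    show "{t\<in>{0..1}. g t $ l = \<tau>} = {} \<or>
      (\<exists>p q. p \<le> q \<and> {t\<in>{0..1}. g t $ l = \<tau>} = {p..q} \<and> affine_between g p q)"
      unfolding * using aff affine_between_refl[of g] by (metis order_refl zero_le_one)
  qed (use lip in \<open>auto simp: g_def\<close>)
  moreover have "sup_arc_length g \<le> ereal L" by (rule sup_arc_length_le) (use lip \<open>0 \<le> L\<close> in auto)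
  ultimately show ?thesis using that by blast
qed

text \<open>A coordinate moves at constant speed from \<open>a\<close> to \<open>\<sigma>\<close> during \<open>{0..u}\<close>, rests until \<open>v\<close>,
  and then moves at constant speed to \<open>b\<close>. If \<open>u = 0\<close> or \<open>v = 1\<close>, the corresponding term vanishes,
  which is right when \<open>a = \<sigma>\<close> or \<open>b = \<sigma>\<close>, respectively.\<close>

definition resting :: "real \<Rightarrow> real \<Rightarrow> real \<Rightarrow> real \<Rightarrow> real \<Rightarrow> real \<Rightarrow> real" where
  "resting a \<sigma> b u v t =
     \<sigma> * (1 - (1 - \<sigma> * a) / u * max 0 (u - t) - (1 - \<sigma> * b) / (1 - v) * max 0 (t - v))"

context
  fixes a \<sigma> b u v L :: real
  assumes \<sigma>: "\<sigma> \<in> {1, -1}" and ab: "\<bar>a\<bar> \<le> 1" "\<bar>b\<bar> \<le> 1" and uv: "0 \<le> u" "u \<le> v" "v \<le> 1"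
    and speed: "1 - \<sigma> * a \<le> L * u" "1 - \<sigma> * b \<le> L * (1 - v)"
begin

lemma resting_slopes:
  obtains c d where "0 \<le> c" "c \<le> L \<or> c = 0" "0 \<le> d" "d \<le> L \<or> d = 0"
    "c * u = 1 - \<sigma> * a" "d * (1 - v) = 1 - \<sigma> * b"
    "\<And>t. resting a \<sigma> b u v t = \<sigma> * (1 - c * max 0 (u - t) - d * max 0 (t - v))"
proof
  have n: "0 \<le> 1 - \<sigma> * a" "0 \<le> 1 - \<sigma> * b" using \<sigma> ab by auto
  show "0 \<le> (1 - \<sigma> * a) / u" "0 \<le> (1 - \<sigma> * b) / (1 - v)"
    using n uv by auto
  show "(1 - \<sigma> * a) / u * u = 1 - \<sigma> * a" "(1 - \<sigma> * b) / (1 - v) * (1 - v) = 1 - \<sigma> * b"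
    using n speed by auto
  show "(1 - \<sigma> * a) / u \<le> L \<or> (1 - \<sigma> * a) / u = 0"
    using speed uv by (cases "u = 0") (auto simp: divide_simps mult.commute)
  show "(1 - \<sigma> * b) / (1 - v) \<le> L \<or> (1 - \<sigma> * b) / (1 - v) = 0"
    using speed uv by (cases "v = 1") (auto simp: divide_simps mult.commute)
qed (simp add: resting_def)

lemma resting_ends: "resting a \<sigma> b u v 0 = a" "resting a \<sigma> b u v 1 = b"
proof -
  obtain c d where "c * u = 1 - \<sigma> * a" "d * (1 - v) = 1 - \<sigma> * b"
    "\<And>t. resting a \<sigma> b u v t = \<sigma> * (1 - c * max 0 (u - t) - d * max 0 (t - v))"
    by (rule resting_slopes) blast
  then show "resting a \<sigma> b u v 0 = a" "resting a \<sigma> b u v 1 = b"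
    using \<sigma> uv by (auto simp: max_def)
qed

lemma resting_lipschitz:
  assumes "x \<le> y" "0 \<le> L"
  shows "\<bar>resting a \<sigma> b u v y - resting a \<sigma> b u v x\<bar> \<le> L * (y - x)"
proof -
  obtain c d where cd: "0 \<le> c" "c \<le> L \<or> c = 0" "0 \<le> d" "d \<le> L \<or> d = 0"
    and r: "\<And>t. resting a \<sigma> b u v t = \<sigma> * (1 - c * max 0 (u - t) - d * max 0 (t - v))"
    by (rule resting_slopes) blast
  define C where "C = max 0 (u - x) - max 0 (u - y)"
  define D where "D = max 0 (y - v) - max 0 (x - v)"
  have CD: "0 \<le> C" "0 \<le> D" "C + D \<le> y - x" using assms uv by (auto simp: C_def D_def max_def)
  have "resting a \<sigma> b u v y - resting a \<sigma> b u v x = \<sigma> * (c * C - d * D)"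
    by (simp add: r C_def D_def algebra_simps)
  then have "\<bar>resting a \<sigma> b u v y - resting a \<sigma> b u v x\<bar> = \<bar>c * C - d * D\<bar>"
    using \<sigma> by (auto simp: abs_mult)
  also have "\<dots> \<le> c * C + d * D" using cd CD by (simp add: abs_le_iff)
  also have "\<dots> \<le> L * C + L * D" using cd CD \<open>0 \<le> L\<close> by (intro add_mono mult_right_mono) auto
  also have "\<dots> \<le> L * (y - x)"
    using mult_left_mono[OF CD(3) \<open>0 \<le> L\<close>] by (simp add: algebra_simps)
  finally show ?thesis .
qed

lemma resting_affine:
  assumes "p \<le> q" "q \<le> u \<or> u \<le> p" "q \<le> v \<or> v \<le> p"
  shows "affine_between (resting a \<sigma> b u v) p q"
  unfolding affine_between_def
proof
  obtain c d where
    r: "\<And>t. resting a \<sigma> b u v t = \<sigma> * (1 - c * max 0 (u - t) - d * max 0 (t - v))"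
    by (rule resting_slopes) blast
  fix l :: real assume l: "l \<in> {0..1}"
  let ?z = "(1 - l) * p + l * q"
  have z: "p \<le> ?z" "?z \<le> q"
  proof -
    have "0 \<le> l * (q - p)" "0 \<le> (1 - l) * (q - p)"
      using l \<open>p \<le> q\<close> by (auto intro!: mult_nonneg_nonneg)
    then show "p \<le> ?z" "?z \<le> q" by (auto simp: algebra_simps)
  qed
  have "max 0 (u - ?z) = (1 - l) * max 0 (u - p) + l * max 0 (u - q)"
    using assms(2)
  proof
    assume "q \<le> u"
    then have "max 0 (u - ?z) = u - ?z" "max 0 (u - p) = u - p" "max 0 (u - q) = u - q"
      using z \<open>p \<le> q\<close> by auto
    then show ?thesis by (simp add: algebra_simps)
  next
    assume "u \<le> p"
    then have "max 0 (u - ?z) = 0" "max 0 (u - p) = 0" "max 0 (u - q) = 0"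
      using z \<open>p \<le> q\<close> by auto
    then show ?thesis by simp
  qed
  moreover have "max 0 (?z - v) = (1 - l) * max 0 (p - v) + l * max 0 (q - v)"
    using assms(3)
  proof
    assume "q \<le> v"
    then have "max 0 (?z - v) = 0" "max 0 (p - v) = 0" "max 0 (q - v) = 0"
      using z \<open>p \<le> q\<close> by auto
    then show ?thesis by simp
  next
    assume "v \<le> p"
    then have "max 0 (?z - v) = ?z - v" "max 0 (p - v) = p - v" "max 0 (q - v) = q - v"
      using z \<open>p \<le> q\<close> by auto
    then show ?thesis by (simp add: algebra_simps)
  qed
  ultimately show "resting a \<sigma> b u v ?z =
      (1 - l) *\<^sub>R resting a \<sigma> b u v p + l *\<^sub>R resting a \<sigma> b u v q"
    by (simp only: r real_scaleR_def) (simp add: algebra_simps)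
qed

lemma resting_range:
  assumes t: "0 \<le> t" "t \<le> 1"
  shows resting_le_1: "\<bar>resting a \<sigma> b u v t\<bar> \<le> 1"
    and resting_eq_minus: "resting a \<sigma> b u v t = - \<sigma> \<Longrightarrow> t = 0 \<and> a = - \<sigma> \<or> t = 1 \<and> b = - \<sigma>"
    and resting_eq: "(a = \<sigma> \<longrightarrow> u = 0) \<Longrightarrow> (b = \<sigma> \<longrightarrow> v = 1) \<Longrightarrow>
      resting a \<sigma> b u v t = \<sigma> \<longleftrightarrow> u \<le> t \<and> t \<le> v"
proof -
  obtain c d where cd: "0 \<le> c" "0 \<le> d"
    and e: "c * u = 1 - \<sigma> * a" "d * (1 - v) = 1 - \<sigma> * b"
    and r: "\<And>t. resting a \<sigma> b u v t = \<sigma> * (1 - c * max 0 (u - t) - d * max 0 (t - v))"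
    by (rule resting_slopes) blast
  have two: "c * u \<le> 2" "d * (1 - v) \<le> 2" using e ab \<sigma> by auto
  have eq_iff: "a = \<sigma> \<longleftrightarrow> c * u = 0" "b = \<sigma> \<longleftrightarrow> d * (1 - v) = 0" unfolding e using \<sigma> by auto
  have minus_iff: "a = - \<sigma> \<longleftrightarrow> c * u = 2" "b = - \<sigma> \<longleftrightarrow> d * (1 - v) = 2" unfolding e using \<sigma> by auto
  have sign: "\<bar>\<sigma> * (1 - y)\<bar> \<le> 1 \<longleftrightarrow> 0 \<le> y \<and> y \<le> 2" "\<sigma> * (1 - y) = - \<sigma> \<longleftrightarrow> y = 2"
    "\<sigma> * (1 - y) = \<sigma> \<longleftrightarrow> y = 0" for y
    using \<sigma> by auto
  consider "t < u" | "u \<le> t" "t \<le> v" | "v < t" by linarith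
  then have "\<bar>resting a \<sigma> b u v t\<bar> \<le> 1 \<and>
    (resting a \<sigma> b u v t = - \<sigma> \<longrightarrow> t = 0 \<and> a = - \<sigma> \<or> t = 1 \<and> b = - \<sigma>) \<and>
    ((a = \<sigma> \<longrightarrow> u = 0) \<longrightarrow> (b = \<sigma> \<longrightarrow> v = 1) \<longrightarrow>
      (resting a \<sigma> b u v t = \<sigma> \<longleftrightarrow> u \<le> t \<and> t \<le> v))"
  proof cases
    case 1
    then have rt: "resting a \<sigma> b u v t = \<sigma> * (1 - c * (u - t))" using uv by (simp add: r max_def)
    have "0 \<le> c * (u - t)" using cd 1 by (intro mult_nonneg_nonneg) auto
    moreover have "t = 0" if "c * (u - t) = 2"
    proof (rule ccontr)
      assume "t \<noteq> 0"
      then have "0 < c * t" using cd t that by (cases "c = 0") auto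
      then show False using that two by (simp add: right_diff_distrib)
    qed
    moreover have "0 \<le> c * t" "c * (u - t) = c * u - c * t"
      using cd t by (simp_all add: right_diff_distrib)
    ultimately show ?thesis unfolding rt sign eq_iff minus_iff using two 1 t by auto
  next
    case 2
    then have rt: "resting a \<sigma> b u v t = \<sigma> * (1 - 0)" by (simp add: r max_def)
    show ?thesis unfolding rt sign using 2 by auto
  next
    case 3
    then have rt: "resting a \<sigma> b u v t = \<sigma> * (1 - d * (t - v))" using uv by (simp add: r max_def)
    have "0 \<le> d * (t - v)" using cd 3 by (intro mult_nonneg_nonneg) auto
    moreover have "t = 1" if "d * (t - v) = 2"
    proof (rule ccontr)
      assume "t \<noteq> 1"
      then have "0 < d * (1 - t)" using cd t that by (cases "d = 0") auto
      then show False using that two by (simp add: right_diff_distrib)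
    qed
    moreover have "0 \<le> d * (1 - t)" using cd t by (intro mult_nonneg_nonneg) auto
    moreover have "d * (t - v) = d * (1 - v) - d * (1 - t)" by (simp add: right_diff_distrib)
    ultimately show ?thesis unfolding rt sign eq_iff minus_iff using two 3 t by auto
  qed
  then show "\<bar>resting a \<sigma> b u v t\<bar> \<le> 1"
    "resting a \<sigma> b u v t = - \<sigma> \<Longrightarrow> t = 0 \<and> a = - \<sigma> \<or> t = 1 \<and> b = - \<sigma>"
    "(a = \<sigma> \<longrightarrow> u = 0) \<Longrightarrow> (b = \<sigma> \<longrightarrow> v = 1) \<Longrightarrow>
      resting a \<sigma> b u v t = \<sigma> \<longleftrightarrow> u \<le> t \<and> t \<le> v"
    by blast+
qed

end

text \<open>If \<open>A\<close> and \<open>B\<close> share a facet, the straight segment is short enough. Otherwise take a chain with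
  the fewest facets and write \<open>\<alpha> t\<close> and \<open>\<beta> t\<close> for the distances of \<open>A\<close> and \<open>B\<close> to its facet number
  \<open>t\<close>. If \<open>\<alpha> t \<ge> \<alpha> (t + 1)\<close> with \<open>t\<close> interior, facet number \<open>t\<close> could be left out; if
  \<open>\<beta> t \<le> \<beta> (t + 1)\<close> with \<open>t + 1\<close> interior, facet number \<open>t + 1\<close> could. Hence it is consistent to
  enter facet number \<open>t \<le> m\<close> after travelling \<open>\<alpha> t\<close>, and the last facet when \<open>\<beta> m\<close> remains to be
  travelled. Each coordinate of the chain rests while the curve lies on its facet and moves with speed
  at most \<open>L\<close> otherwise; the other coordinates move uniformly.\<close>

lemma chain_gives_curve:
  fixes A B :: "real ^ 'n"
  assumes A: "A \<in> sup_sphere" and B: "B \<in> sup_sphere" and Ai: "A $ i = 1" and Bj: "B $ j = 1"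
    and chain: "facet_chain i j A B L m F" and L: "infnorm (B - A) \<le> L"
  obtains g where "admissible_path A B g" "sup_arc_length g \<le> ereal L"
proof (cases "\<exists>k. \<bar>A $ k\<bar> = 1 \<and> B $ k = A $ k")
  case True
  then show ?thesis using admissible_path_straight[OF A B _ refl _ L] that by metis
next
  case False
  then have "\<bar>A $ k\<bar> = 1 \<longrightarrow> B $ k \<noteq> A $ k" for k by blast
  then have apart: "\<not> (A $ k = \<sigma> \<and> B $ k = \<sigma>)" if "\<sigma> \<in> {1, -1}" for k \<sigma>
    using that by (metis abs_1 abs_minus_cancel insertE singletonD)
  define m where "m = (LEAST m. \<exists>F. facet_chain i j A B L m F)"
  have "\<exists>m F. facet_chain i j A B L m F" using chain by blast
  then have "\<exists>F. facet_chain i j A B L m F" unfolding m_def by (rule LeastI_ex)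
  then obtain F where F: "facet_chain i j A B L m F" by blast
  have min: "\<not> facet_chain i j A B L m' F'" if "m' < m" for m' F'
    using not_less_Least[of m' "\<lambda>m. \<exists>F. facet_chain i j A B L m F"] that m_def by auto
  have inj: "inj_on (fst \<circ> F) {..Suc m}" and sign: "\<And>t. t \<le> Suc m \<Longrightarrow> snd (F t) \<in> {1, -1}"
    and F0: "F 0 = (i, 1)" and Fm: "F (Suc m) = (j, 1)"
    using F by (auto simp: facet_chain_def walk_def)
  have bound: "\<bar>A $ k\<bar> \<le> 1" "\<bar>B $ k\<bar> \<le> 1" for k using A B by (auto simp: sup_sphere_iff)

  define \<alpha> where "\<alpha> = (\<lambda>t. gap A (F t))"
  define \<beta> where "\<beta> = (\<lambda>t. gap B (F t))"
  have nonneg: "0 \<le> \<alpha> t" "0 \<le> \<beta> t" if "t \<le> Suc m" for t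
    using sign[OF that] bound[of "fst (F t)"] by (auto simp: \<alpha>_def \<beta>_def gap_def)
  have ends: "\<alpha> 0 = 0" "\<beta> (Suc m) = 0" using F0 Fm Ai Bj by (auto simp: \<alpha>_def \<beta>_def gap_def)
  \<comment> \<open>Here the assumption that no facet is shared enters.\<close>
  have pos: "0 < \<alpha> (Suc m)" "0 < \<beta> 0"
    using F0 Fm Ai Bj apart[of 1 i] apart[of 1 j] bound(1)[of j] bound(2)[of i]
    by (auto simp: \<alpha>_def \<beta>_def gap_def)
  have link: "\<beta> t + \<alpha> (Suc t) \<le> L" if "t \<le> m" for t
    using F that by (auto simp: facet_chain_def walk_def linked_def \<alpha>_def \<beta>_def)
  have no_link: "L < \<beta> t + \<alpha> (Suc (Suc t))" if "t < m" for t
  proof (rule ccontr)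
    assume "\<not> L < \<beta> t + \<alpha> (Suc (Suc t))"
    then have "linked A B L (F t) (F (Suc (Suc t)))" by (simp add: linked_def \<alpha>_def \<beta>_def)
    from facet_chain_leap[OF F _ _ this] that min show False by fastforce
  qed
  have \<alpha>_inc: "\<alpha> t \<le> \<alpha> (Suc t)" if "t \<le> m" for t
    using link[of "t - 1"] no_link[of "t - 1"] nonneg[of "Suc t"] ends that by (cases t) auto
  have \<beta>_dec: "\<beta> (Suc t) < \<beta> t" if "t < m" for t
    using link[of "Suc t"] no_link[of t] that by auto
  have "0 < L" using link[of 0] pos nonneg[of "Suc 0"] by auto

  \<comment> \<open>Facet number \<open>t\<close> is occupied exactly during \<open>{s t..s (Suc t)}\<close>.\<close>
  define s where "s = (\<lambda>t. if t \<le> m then \<alpha> t / L else if t = Suc m then (L - \<beta> m) / L else 1)"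
  have Ls: "L * s t = (if t \<le> m then \<alpha> t else if t = Suc m then L - \<beta> m else L)" for t
    using \<open>0 < L\<close> by (auto simp: s_def)
  have "s t \<le> s (Suc t)" for t
  proof -
    have "\<alpha> m \<le> L - \<beta> m"
    proof (cases m)
      case 0
      then show ?thesis using link[of 0] nonneg[of 1] ends by auto
    next
      case (Suc r)
      then show ?thesis using link[of r] \<beta>_dec[of r] by auto
    qed
    then have "L * s t \<le> L * s (Suc t)"
      unfolding Ls using \<alpha>_inc[of t] nonneg[of m] by (auto simp: le_Suc_eq)
    then show ?thesis using \<open>0 < L\<close> by simp
  qed
  then have s_mono: "s t \<le> s t'" if "t \<le> t'" for t t'
    using that by (rule lift_Suc_mono_le)
  have s0: "s 0 = 0" and s_end: "s (Suc (Suc m)) = 1" using ends by (auto simp: s_def)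
  have s_range: "0 \<le> s t" "t \<le> Suc (Suc m) \<Longrightarrow> s t \<le> 1" for t
    using s_mono[of 0 t] s0 s_mono[of t "Suc (Suc m)"] s_end by auto
  have speed: "\<alpha> t \<le> L * s t" "\<beta> t \<le> L * (1 - s (Suc t))" if "t \<le> Suc m" for t
  proof -
    show "\<alpha> t \<le> L * s t" unfolding Ls using that link[of m] by (auto simp: le_Suc_eq)
    have "L * (1 - s (Suc t)) = L - L * s (Suc t)" by (simp add: right_diff_distrib)
    then show "\<beta> t \<le> L * (1 - s (Suc t))"
      unfolding Ls using that link[of t] ends by (auto simp: le_Suc_eq)
  qed
  \<comment> \<open>If \<open>A\<close> or \<open>B\<close> lies on a facet of the chain, that facet is occupied from the start or up to the
    end, so the curve does not meet it in a separate point.\<close>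
  have touching: "\<alpha> t = 0 \<longrightarrow> s t = 0" "\<beta> t = 0 \<longrightarrow> s (Suc t) = 1" if "t \<le> Suc m" for t
  proof -
    show "\<alpha> t = 0 \<longrightarrow> s t = 0" using that pos by (auto simp: s_def le_Suc_eq)
    show "\<beta> t = 0 \<longrightarrow> s (Suc t) = 1"
    proof (cases "t < m")
      case True
      then show ?thesis using \<beta>_dec[of t] nonneg[of "Suc t"] by auto
    next
      case False
      then have "t = m \<or> t = Suc m" using that by auto
      then show ?thesis using \<open>0 < L\<close> by (auto simp: s_def)
    qed
  qed

  define used where "used = (fst \<circ> F) ` {..Suc m}"
  define r where "r = (\<lambda>t. resting (A $ fst (F t)) (snd (F t)) (B $ fst (F t)) (s t) (s (Suc t)))"
  define g where "g = (\<lambda>\<tau>. \<chi> k. if k \<in> used then r (inv_into {..Suc m} (fst \<circ> F) k) \<tau>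
      else (1 - \<tau>) * A $ k + \<tau> * B $ k)"
  have g_used: "g \<tau> $ fst (F t) = r t \<tau>" if "t \<le> Suc m" for t \<tau>
  proof -
    have "inv_into {..Suc m} (fst \<circ> F) (fst (F t)) = t"
      using inv_into_f_f[OF inj, of t] that by simp
    moreover have "fst (F t) \<in> used" using that by (auto simp: used_def)
    ultimately show ?thesis by (simp add: g_def)
  qed
  have g_unused: "g \<tau> $ k = (1 - \<tau>) * A $ k + \<tau> * B $ k" if "k \<notin> used" for k \<tau>
    using that by (simp add: g_def)
  have usedE: thesis if "k \<in> used" "\<And>t. t \<le> Suc m \<Longrightarrow> k = fst (F t) \<Longrightarrow> thesis" for k thesis
    using that by (auto simp: used_def)
  have rest: "snd (F t) \<in> {1, -1}" "\<bar>A $ fst (F t)\<bar> \<le> 1" "\<bar>B $ fst (F t)\<bar> \<le> 1"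
      "0 \<le> s t" "s t \<le> s (Suc t)" "s (Suc t) \<le> 1"
      "1 - snd (F t) * A $ fst (F t) \<le> L * s t" "1 - snd (F t) * B $ fst (F t) \<le> L * (1 - s (Suc t))"
    if "t \<le> Suc m" for t
    using sign that bound s_range s_mono speed[of t] by (auto simp: \<alpha>_def \<beta>_def gap_def)
  have r_eq: "r t \<tau> = snd (F t) \<longleftrightarrow> s t \<le> \<tau> \<and> \<tau> \<le> s (Suc t)"
    if "t \<le> Suc m" "0 \<le> \<tau>" "\<tau> \<le> 1" for t \<tau>
    unfolding r_def
  proof (rule resting_eq[OF rest that(2,3)])
    show "A $ fst (F t) = snd (F t) \<longrightarrow> s t = 0" "B $ fst (F t) = snd (F t) \<longrightarrow> s (Suc t) = 1"
      using touching[OF that(1)] sign[OF that(1)] by (auto simp: \<alpha>_def \<beta>_def gap_def)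
  qed (use that in auto)

  have lip: "infnorm (g y - g x) \<le> L * (y - x)" if xy: "x \<le> y" for x y
    unfolding infnorm_cart_le_iff
  proof
    fix k
    show "\<bar>(g y - g x) $ k\<bar> \<le> L * (y - x)"
    proof (cases "k \<in> used")
      case True
      then obtain t where "t \<le> Suc m" "k = fst (F t)" by (rule usedE)
      then show ?thesis
        using resting_lipschitz[OF rest xy, of t] \<open>0 < L\<close> by (simp add: g_used r_def)
    next
      case False
      have "(g y - g x) $ k = (y - x) * (B - A) $ k"
        using False by (simp add: g_unused algebra_simps)
      then have "\<bar>(g y - g x) $ k\<bar> = (y - x) * \<bar>(B - A) $ k\<bar>" using xy by (simp add: abs_mult)
      also have "\<dots> \<le> (y - x) * L"
        using L component_le_infnorm_cart[of "B - A" k] xy by (intro mult_left_mono) auto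
      finally show ?thesis by (simp add: mult.commute)
    qed
  qed
  have aff: "affine_between g (s t) (s (Suc t))" for t
    unfolding affine_between_def
  proof (intro ballI, subst vec_eq_iff, intro allI)
    fix l :: real and k assume l: "l \<in> {0..1}"
    show "g ((1 - l) * s t + l * s (Suc t)) $ k = ((1 - l) *\<^sub>R g (s t) + l *\<^sub>R g (s (Suc t))) $ k"
    proof (cases "k \<in> used")
      case True
      then obtain t' where t': "t' \<le> Suc m" "k = fst (F t')" by (rule usedE)
      have "s (Suc t) \<le> s t' \<or> s t' \<le> s t" "s (Suc t) \<le> s (Suc t') \<or> s (Suc t') \<le> s t"
        using s_mono by (meson not_less_eq_eq nat_le_linear Suc_le_mono)+
      from resting_affine[OF rest[OF t'(1)] s_mono this] l show ?thesis
        by (simp add: t'(2) g_used[OF t'(1)] r_def affine_between_def)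
    next
      case False
      then show ?thesis by (simp add: g_unused algebra_simps)
    qed
  qed
  have "admissible_path A B g"
  proof (rule admissible_pathI)
    show "g 0 = A" "g 1 = B"
    proof -
      have "g 0 $ k = A $ k \<and> g 1 $ k = B $ k" for k
      proof (cases "k \<in> used")
        case True
        then obtain t where "t \<le> Suc m" "k = fst (F t)" by (rule usedE)
        then show ?thesis using resting_ends[OF rest, of t] by (simp add: g_used r_def)
      qed (simp add: g_unused)
      then show "g 0 = A" "g 1 = B" by (simp_all add: vec_eq_iff)
    qed
  next
    fix \<tau> :: real assume \<tau>: "0 \<le> \<tau>" "\<tau> \<le> 1"
    have "\<bar>g \<tau> $ k\<bar> \<le> 1" for k
    proof (cases "k \<in> used")
      case True
      then obtain t where "t \<le> Suc m" "k = fst (F t)" by (rule usedE)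
      then show ?thesis using resting_le_1[OF rest \<tau>, of t] by (simp add: g_used r_def)
    next
      case False
      then show ?thesis
        using abs_convex_combination_le[OF bound[of k] \<tau>] by (simp add: g_unused)
    qed
    moreover have "\<exists>k. \<bar>g \<tau> $ k\<bar> = 1"
    proof -
      define t where "t = Max {t. t \<le> Suc m \<and> s t \<le> \<tau>}"
      have "t \<in> {t. t \<le> Suc m \<and> s t \<le> \<tau>}"
        unfolding t_def by (rule Max_in) (use s0 \<tau> in auto)
      then have t: "t \<le> Suc m" "s t \<le> \<tau>" by auto
      have "\<tau> \<le> s (Suc t)"
      proof (cases "t = Suc m")
        case False
        show ?thesis
        proof (rule ccontr)
          assume "\<not> \<tau> \<le> s (Suc t)"
          then have "Suc t \<le> t"
            using False t unfolding t_def by (intro Max_ge) (auto simp: t_def[symmetric])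
          then show False by simp
        qed
      qed (use \<tau> s_end in simp)
      with t \<tau> have "r t \<tau> = snd (F t)" using r_eq by blast
      then show ?thesis using g_used[of t \<tau>] t sign[of t] by (intro exI[of _ "fst (F t)"]) auto
    qed
    ultimately show "g \<tau> \<in> sup_sphere" by (simp add: sup_sphere_iff)
  next
    fix k and \<sigma> :: real assume \<sigma>: "\<sigma> \<in> {1, -1}"
    let ?T = "{\<tau>\<in>{0..1}. g \<tau> $ k = \<sigma>}"
    \<comment> \<open>A facet off the chain can only be met at an endpoint of the curve, and not at both.\<close>
    have single: "?T = {} \<or> (\<exists>p q. p \<le> q \<and> ?T = {p..q} \<and> affine_between g p q)"
      if "\<And>\<tau>. \<tau> \<in> ?T \<Longrightarrow> \<tau> = 0 \<and> A $ k = \<sigma> \<or> \<tau> = 1 \<and> B $ k = \<sigma>"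
    proof -
      have "?T \<subseteq> {if A $ k = \<sigma> then 0 else 1}" using that apart[OF \<sigma>, of k] by auto
      then have "?T = {} \<or> (\<exists>p. ?T = {p..p})" by (metis atLeastAtMost_singleton subset_singletonD)
      then show ?thesis using affine_between_refl by blast
    qed
    show "?T = {} \<or> (\<exists>p q. p \<le> q \<and> ?T = {p..q} \<and> affine_between g p q)"
    proof (cases "k \<in> used")
      case True
      then obtain t where t: "t \<le> Suc m" "k = fst (F t)" by (rule usedE)
      show ?thesis
      proof (cases "\<sigma> = snd (F t)")
        case True
        have "?T = {s t..s (Suc t)}"
          using r_eq[OF t(1)] s_range(1)[of t] s_range(2)[of "Suc t"] t True
          by (auto simp: g_used)
        then show ?thesis using aff s_mono by (metis lessI less_imp_le)
      next
        case False
        then have minus: "\<sigma> = - snd (F t)" using \<sigma> sign[OF t(1)] by auto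
        have "\<tau> = 0 \<and> A $ k = \<sigma> \<or> \<tau> = 1 \<and> B $ k = \<sigma>" if "\<tau> \<in> ?T" for \<tau>
          using resting_eq_minus[OF rest[OF t(1)], of \<tau>] that minus t
          by (simp add: g_used r_def)
        then show ?thesis by (rule single)
      qed
    next
      case False
      have "\<tau> = 0 \<and> A $ k = \<sigma> \<or> \<tau> = 1 \<and> B $ k = \<sigma>" if "\<tau> \<in> ?T" for \<tau>
      proof -
        have "(\<tau> = 0 \<or> B $ k = \<sigma>) \<and> (\<tau> = 1 \<or> A $ k = \<sigma>)"
          using straight_coordinate_eq_sign[OF \<sigma> bound, of \<tau> k k] that False by (simp add: g_unused)
        then show ?thesis using apart[OF \<sigma>, of k] by auto
      qed
      then show ?thesis by (rule single)
    qed
  qed (use lip in auto)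
  moreover have "sup_arc_length g \<le> ereal L"
    by (rule sup_arc_length_le) (use lip \<open>0 < L\<close> in auto)
  ultimately show ?thesis using that by blast
qed

section \<open>The numbers and the chains\<close>

lemma direct_number_le_iff:
  fixes A B :: "real ^ 'n"
  shows "direct_number i j A B \<le> L \<longleftrightarrow>
    2 - A $ j - B $ i \<le> L \<and> (\<forall>s. s \<notin> {i, j} \<longrightarrow> \<bar>A $ s - B $ s\<bar> \<le> L)"
  unfolding direct_number_def by (subst Max_le_iff) auto

lemma detour_number_le_iff:
  fixes A B :: "real ^ 'n"
  shows "detour_number i j A B m p \<epsilon> \<le> L \<longleftrightarrow>
    2 - A $ j + \<epsilon> m * B $ p m \<le> L \<and> 2 + \<epsilon> 1 * A $ p 1 - B $ i \<le> L \<and>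
    (\<forall>t. 1 \<le> t \<and> t < m \<longrightarrow> 2 + \<epsilon> (t + 1) * A $ p (t + 1) + \<epsilon> t * B $ p t \<le> L) \<and>
    (\<forall>s. s \<notin> {i, j} \<and> s \<notin> p ` {1..m} \<longrightarrow> \<bar>A $ s - B $ s\<bar> \<le> L)"
  unfolding detour_number_def by (subst Max_le_iff) auto

lemma finite_detour_numbers: "finite (detour_numbers i j A (B :: real ^ 'n))"
proof -
  let ?P = "\<Union>m\<in>{1..CARD('n) - 2}.
    {m} \<times> ({1..m} \<rightarrow>\<^sub>E - {i, j}) \<times> ({1..m} \<rightarrow>\<^sub>E {1, -1 :: real})"
  have "finite ?P" by (intro finite_UN_I finite_cartesian_product finite_PiE) auto
  moreover have "detour_numbers i j A B \<subseteq> (\<lambda>(m, p, \<epsilon>). detour_number i j A B m p \<epsilon>) ` ?P"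
  proof
    fix x assume "x \<in> detour_numbers i j A B"
    then obtain m p \<epsilon> where x: "x = detour_number i j A B m p \<epsilon>" and m: "1 \<le> m" "m \<le> CARD('n) - 2"
      and p: "p \<in> {1..m} \<rightarrow>\<^sub>E - {i, j}" "\<epsilon> \<in> {1..m} \<rightarrow>\<^sub>E {1, -1}"
      unfolding detour_numbers_def by blast
    have "(m, p, \<epsilon>) \<in> ?P" using m by (intro UN_I[of m] SigmaI p) auto
    then show "x \<in> (\<lambda>(m, p, \<epsilon>). detour_number i j A B m p \<epsilon>) ` ?P"
      by (rule rev_image_eqI) (simp add: x)
  qed
  ultimately show ?thesis by (meson finite_imageI finite_subset)
qed

text \<open>The coordinates that occur in a chain need no separate bound: the difference between the
  distances of two points to a facet is at most the larger of these distances.\<close>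

lemma facet_chain_coordinate_le:
  assumes A: "A \<in> sup_sphere" and B: "B \<in> sup_sphere" and Ai: "A $ i = 1" and Bj: "B $ j = 1"
    and F: "facet_chain i j A B L m F" and t: "t \<le> Suc m"
  shows "\<bar>A $ fst (F t) - B $ fst (F t)\<bar> \<le> L"
proof -
  have sign: "snd (F t) \<in> {1, -1}" if "t \<le> Suc m" for t
    using F that by (auto simp: facet_chain_def)
  have nonneg: "0 \<le> gap A (F t)" "0 \<le> gap B (F t)" if "t \<le> Suc m" for t
    using sign[OF that] A B unfolding gap_def sup_sphere_iff
    by (auto simp: abs_le_iff dest: spec[of _ "fst (F t)"])
  have link: "gap B (F t) + gap A (F (Suc t)) \<le> L" if "t \<le> m" for t
    using F that by (auto simp: facet_chain_def walk_def linked_def)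
  have ends: "gap A (F 0) = 0" "gap B (F (Suc m)) = 0"
    using F Ai Bj by (auto simp: facet_chain_def walk_def gap_def)
  have "0 \<le> L" using link[of 0] nonneg[of 0] nonneg[of 1] by auto
  have "gap A (F t) \<le> L"
    using link[of "t - 1"] nonneg[of "t - 1"] ends \<open>0 \<le> L\<close> t by (cases t) auto
  moreover have "gap B (F t) \<le> L"
  proof (cases "t = Suc m")
    case False
    then show ?thesis using link[of t] nonneg(1)[of "Suc t"] t by simp
  qed (use ends \<open>0 \<le> L\<close> in simp)
  ultimately have "\<bar>gap A (F t) - gap B (F t)\<bar> \<le> L" using nonneg[OF t] by linarith
  then show ?thesis using sign[OF t] by (auto simp: gap_def)
qed

lemma infnorm_le_facet_chain:
  assumes "A \<in> sup_sphere" "B \<in> sup_sphere" "A $ i = 1" "B $ j = 1"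
    and "facet_chain i j A B L m F"
    and "\<And>s. s \<notin> (fst \<circ> F) ` {..Suc m} \<Longrightarrow> \<bar>A $ s - B $ s\<bar> \<le> L"
  shows "infnorm (B - A) \<le> L"
  unfolding infnorm_cart_le_iff
proof
  fix s
  show "\<bar>(B - A) $ s\<bar> \<le> L"
    using facet_chain_coordinate_le[OF assms(1-5)] assms(6)[of s]
    by (cases "s \<in> (fst \<circ> F) ` {..Suc m}") (auto simp: abs_minus_commute)
qed

lemma number_gives_chain:
  fixes A B :: "real ^ 'n"
  assumes "i \<noteq> j" and A: "A \<in> sup_sphere" and B: "B \<in> sup_sphere"
    and Ai: "A $ i = 1" and Bj: "B $ j = 1"
    and x: "x \<in> {direct_number i j A B} \<union> detour_numbers i j A B"
  obtains m F where "facet_chain i j A B x m F" "infnorm (B - A) \<le> x"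
proof (cases "x = direct_number i j A B")
  case True
  let ?F = "\<lambda>t. if t = 0 then (i, 1) else (j, 1 :: real)"
  have le: "2 - A $ j - B $ i \<le> x" "\<And>s. s \<notin> {i, j} \<Longrightarrow> \<bar>A $ s - B $ s\<bar> \<le> x"
    using direct_number_le_iff[of i j A B x] True by auto
  have F: "facet_chain i j A B x 0 ?F"
    using le \<open>i \<noteq> j\<close> by (auto simp: facet_chain_def walk_def linked_def gap_def inj_on_def le_Suc_eq)
  have "(fst \<circ> ?F) ` {..Suc 0} = {i, j}" by (auto simp: atMost_Suc)
  then have "infnorm (B - A) \<le> x"
    using infnorm_le_facet_chain[OF A B Ai Bj F] le(2) by simp
  with F show ?thesis by (rule that)
next
  case False
  with x obtain m p \<epsilon> where x: "x = detour_number i j A B m p \<epsilon>" and "1 \<le> m"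
    and p: "p \<in> {1..m} \<rightarrow>\<^sub>E - {i, j}" "inj_on p {1..m}" and \<epsilon>: "\<epsilon> \<in> {1..m} \<rightarrow>\<^sub>E {1, -1}"
    unfolding detour_numbers_def by auto
  define F where "F = (\<lambda>t. if t = 0 then (i, 1) else if t \<le> m then (p t, - \<epsilon> t) else (j, 1))"
  have le: "2 - A $ j + \<epsilon> m * B $ p m \<le> x" "2 + \<epsilon> 1 * A $ p 1 - B $ i \<le> x"
    "\<And>t. 1 \<le> t \<Longrightarrow> t < m \<Longrightarrow> 2 + \<epsilon> (t + 1) * A $ p (t + 1) + \<epsilon> t * B $ p t \<le> x"
    "\<And>s. s \<notin> {i, j} \<Longrightarrow> s \<notin> p ` {1..m} \<Longrightarrow> \<bar>A $ s - B $ s\<bar> \<le> x"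
    using detour_number_le_iff[of i j A B m p \<epsilon> x] x by auto
  have p_range: "p t \<noteq> i \<and> p t \<noteq> j" if "1 \<le> t" "t \<le> m" for t
    using p(1) that by (auto dest!: PiE_mem[of _ _ _ t])
  have p_inj: "p s = p t \<longleftrightarrow> s = t" if "1 \<le> s" "s \<le> m" "1 \<le> t" "t \<le> m" for s t
    using p(2) that by (auto dest: inj_onD)
  have \<epsilon>_range: "\<epsilon> t = 1 \<or> \<epsilon> t = -1" if "1 \<le> t" "t \<le> m" for t
    using PiE_mem[OF \<epsilon>, of t] that by auto
  have "linked A B x (F t) (F (Suc t))" if "t \<le> m" for t
    using le(1,2) le(3)[of t] that \<open>1 \<le> m\<close>
    by (cases "t = 0"; cases "t = m") (auto simp: F_def linked_def gap_def)
  moreover have "inj_on (fst \<circ> F) {..Suc m}"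
  proof (rule linorder_inj_onI')
    fix s t assume "s \<in> {..Suc m}" "t \<in> {..Suc m}" "s < t"
    then show "(fst \<circ> F) s \<noteq> (fst \<circ> F) t"
      using p_range[of s] p_range[of t] p_inj[of s t] \<open>i \<noteq> j\<close> by (auto simp: F_def)
  qed
  moreover have "snd (F t) \<in> {1, -1}" for t
    using \<epsilon>_range[of t] by (auto simp: F_def)
  ultimately have F: "facet_chain i j A B x m F"
    by (simp add: facet_chain_def walk_def) (simp add: F_def)
  have "infnorm (B - A) \<le> x"
  proof (rule infnorm_le_facet_chain[OF A B Ai Bj F])
    fix s assume s: "s \<notin> (fst \<circ> F) ` {..Suc m}"
    have visited: "s \<noteq> fst (F t)" if "t \<le> Suc m" for t using s that by auto
    have "s \<noteq> i" "s \<noteq> j" using visited[of 0] visited[of "Suc m"] by (auto simp: F_def)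
    moreover have "s \<noteq> p t" if "t \<in> {1..m}" for t using visited[of t] that by (auto simp: F_def)
    then have "s \<notin> p ` {1..m}" by blast
    ultimately have "s \<notin> {i, j}" "s \<notin> p ` {1..m}" by auto
    then show "\<bar>A $ s - B $ s\<bar> \<le> x" using le(4) by auto
  qed
  with F show ?thesis by (rule that)
qed

lemma chain_gives_number:
  fixes A B :: "real ^ 'n"
  assumes F: "facet_chain i j A B L m F" and d: "infnorm (B - A) \<le> L" and "i \<noteq> j"
  obtains x where "x \<in> {direct_number i j A B} \<union> detour_numbers i j A B" "x \<le> L"
proof -
  have coord: "\<bar>A $ s - B $ s\<bar> \<le> L" for s
    using d unfolding infnorm_cart_le_iff by (auto simp: abs_minus_commute dest: spec[of _ s])
  have F0: "F 0 = (i, 1)" and Fm: "F (Suc m) = (j, 1)" and inj: "inj_on (fst \<circ> F) {..Suc m}"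
    and sign: "\<And>t. t \<le> Suc m \<Longrightarrow> snd (F t) \<in> {1, -1}"
    and link: "\<And>t. t \<le> m \<Longrightarrow> gap B (F t) + gap A (F (Suc t)) \<le> L"
    using F by (auto simp: facet_chain_def walk_def linked_def)
  show ?thesis
  proof (cases m)
    case 0
    then have "direct_number i j A B \<le> L"
      using link[of 0] F0 Fm coord by (simp add: direct_number_le_iff gap_def)
    then show ?thesis using that by blast
  next
    case (Suc r)
    define p where "p = (\<lambda>t\<in>{1..m}. fst (F t))"
    define \<epsilon> where "\<epsilon> = (\<lambda>t\<in>{1..m}. - snd (F t))"
    have ne: "fst (F t) \<noteq> i \<and> fst (F t) \<noteq> j" if "t \<in> {1..m}" for t
      using inj_onD[OF inj, of t 0] inj_onD[OF inj, of t "Suc m"] that F0 Fm by auto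
    have p: "p \<in> {1..m} \<rightarrow>\<^sub>E - {i, j}" using ne by (auto simp: p_def)
    have p_inj: "inj_on p {1..m}"
      using inj by (auto simp: p_def inj_on_def)
    have "m = card (p ` {1..m})" using card_image[OF p_inj] by simp
    also have "\<dots> \<le> card (- {i, j})" using p by (intro card_mono) auto
    also have "\<dots> = CARD('n) - 2" using \<open>i \<noteq> j\<close> by (simp add: card_Diff_subset Compl_eq_Diff_UNIV)
    finally have "m \<le> CARD('n) - 2" .
    moreover have "\<epsilon> \<in> {1..m} \<rightarrow>\<^sub>E {1, -1}"
    proof (rule PiE_I)
      fix t assume "t \<in> {1..m}"
      then show "\<epsilon> t \<in> {1, -1}" using sign[of t] by (auto simp: \<epsilon>_def)
    qed (auto simp: \<epsilon>_def)
    ultimately have mem: "detour_number i j A B m p \<epsilon> \<in> detour_numbers i j A B"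
      using p p_inj Suc unfolding detour_numbers_def by auto
    have gap_p: "gap x (F t) = 1 + \<epsilon> t * x $ p t" if "1 \<le> t" "t \<le> m" for x t
      using that by (simp add: gap_def p_def \<epsilon>_def)
    have "2 + \<epsilon> (t + 1) * A $ p (t + 1) + \<epsilon> t * B $ p t \<le> L" if "1 \<le> t" "t < m" for t
      using link[of t] gap_p[of t] gap_p[of "Suc t"] that by simp
    moreover have "2 - A $ j + \<epsilon> m * B $ p m \<le> L"
      using link[of m] gap_p[of m B] Suc Fm by (simp add: gap_def)
    moreover have "2 + \<epsilon> 1 * A $ p 1 - B $ i \<le> L"
      using link[of 0] gap_p[of 1 A] Suc F0 by (simp add: gap_def)
    ultimately have "detour_number i j A B m p \<epsilon> \<le> L"
      using coord by (simp add: detour_number_le_iff)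
    then show ?thesis using that mem by blast
  qed
qed

section \<open>The geodesic distance\<close>

theorem theorem3:
  fixes A B :: "real ^ 'n" and i j :: 'n
  assumes "CARD('n) \<ge> 3"
    and "i \<noteq> j"
    and "A \<in> sup_sphere" and "A $ i = 1"
    and "B \<in> sup_sphere" and "B $ j = 1"
  shows "is_geodesic_dist A B (Min ({direct_number i j A B} \<union> detour_numbers i j A B))"
proof -
  let ?S = "{direct_number i j A B} \<union> detour_numbers i j A B"
  have fin: "finite ?S" using finite_detour_numbers by simp
  then have "Min ?S \<in> ?S" by (rule Min_in) simp
  then obtain m F where "facet_chain i j A B (Min ?S) m F" "infnorm (B - A) \<le> Min ?S"
    by (rule number_gives_chain[OF assms(2,3,5,4,6)])
  then obtain g where g: "admissible_path A B g" "sup_arc_length g \<le> ereal (Min ?S)"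
    by (rule chain_gives_curve[OF assms(3,5,4,6)])
  have lower: "ereal (Min ?S) \<le> sup_arc_length h" if h: "admissible_path A B h" for h
  proof (cases "sup_arc_length h")
    case (real L)
    have edges: "infnorm (h y - h x) + infnorm (h z - h y) \<le> L"
      if "0 \<le> x" "x \<le> y" "y \<le> z" "z \<le> 1" for x y z
      using sup_arc_length_ge_two_edges[OF that, of h] real by simp
    have path: "path h" "path_image h \<subseteq> sup_sphere" "h 0 = A" "h 1 = B"
      using h by (auto simp: admissible_path_def pathstart_def pathfinish_def)
    obtain m F where F: "facet_chain i j A B L m F"
      by (rule curve_gives_chain[OF path assms(4,6,2) edges])
    have "infnorm (B - A) \<le> L" using edges[of 0 1 1] path by (simp add: infnorm_0)
    then obtain x where "x \<in> ?S" "x \<le> L" by (rule chain_gives_number[OF F _ assms(2)])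
    then show ?thesis using Min_le[OF fin] real by fastforce
  next
    case MInf
    then show ?thesis using sup_arc_length_ge_two_edges[of 0 0 0 h] by (simp add: infnorm_0)
  qed simp
  with g show ?thesis unfolding is_geodesic_dist_def by (meson antisym)
qed

end
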